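(* Let $\theta\in[0,\frac12]$ and let $(U_h^n,\Sigma_h^n)\in L_h\times L_h$, $0\le n\le N$, together with the coarse solution $(u_H^n,\sigma_H^n)\in L_H\times L_H$, be a solution of the two-grid mixed finite element (TGMFE) system described in the context (Steps I and II). Then there is a constant $C>0$, independent of $h$, $H$ and $\Delta t$, such that for $2\le n\le N$ $$\|U_h^{n}\|^2+\Delta t\sum_{k=2}^n\|\nabla U_h^{k-\theta}\|^2+\gamma\Delta t\sum_{k=2}^n\|\Sigma_h^{k-\theta}\|^2\leq C\Big(\|U_h^{0}\|^2+\|u_H^{0}\|^2+\Delta t\sum_{k=1}^n\|g^{k}\|^2\Big).$$
   Context: $\Omega\subset\mathbb{R}^d$, $d\le 2$, is a bounded convex polygonal domain, $J=(0,T]$ with $0<T<\infty$. The underlying problem is $u_t+\gamma\Delta^2u-\Delta u+f(u)=g(\mathbf z,t)$ in $\Omega\times J$, $u(\cdot,0)=u_0$, $u=\Delta u=0$ on $\partial\Omega\times\bar J$, where $\gamma>0$ is constant and the (differentiable) nonlinear term $f$ satisfies $|f(a)-f(b)|\le C|a-b|$. It is rewritten with $\sigma=\Delta u$. $(\cdot,\cdot)$ and $\|\cdot\|$ are the $L^2(\Omega)$ inner product and norm. $L_H\subset L_h\subset H_0^1(\Omega)$ are finite element spaces on a coarse mesh of size $H$ and a fine mesh of size $h$. Time grid: $t_n=n\Delta t$, $\Delta t=T/N$, $0\le n\le N$; $g^n=g(\cdot,t_n)$. For a sequence $\{\phi^n\}$: for $n\ge2$, $\mathcal{D}_t\phi^{n-\theta}=\frac{(3-2\theta)\phi^{n}-(4-4\theta)\phi^{n-1}+(1-2\theta)\phi^{n-2}}{2\Delta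 t}$ and $\phi^{n-\theta}=(1-\theta)\phi^n+\theta\phi^{n-1}$; $f^{n-\theta}(\phi)=(1-\theta)f(\phi^n)+\theta f(\phi^{n-1})$. For the first step, $\mathcal{D}_t\phi^{\frac12}=\frac{\phi^1-\phi^0}{\Delta t}$, $\phi^{\frac12}=\frac12(\phi^1+\phi^0)$, $f^{\frac12}(\phi)=\frac12(f(\phi^1)+f(\phi^0))$. Step I (nonlinear coarse system). Given $(u_H^0,\sigma_H^0)\in L_H\times L_H$, $(u_H^n,\sigma_H^n)\in L_H\times L_H$ satisfy, for $n\ge2$ and all $v_H,w_H\in L_H$, $$(\mathcal{D}_tu_H^{n-\theta},v_H)-\gamma(\nabla \sigma_H^{n-\theta},\nabla v_H)+(\nabla u_H^{n-\theta},\nabla v_H)+(f^{n-\theta}(u_H),v_H)=(g^{n-\theta},v_H),$$ $$(\sigma_H^{n-\theta},w_H)+(\nabla u_H^{n-\theta},\nabla w_H)=0,$$ and, for $n=1$, the same two equations with every superscript $n-\theta$ replaced by $\frac12$. Step II (linear fine system). Put $\mathfrak{F}(U_h^n,u_H^n)=f(u_H^n)+f'(u_H^n)(U_h^n-u_H^n)$. Given $(U_h^0,\Sigma_h^0)\in L_h\times L_h$, $(U_h^n,\Sigma_h^n)\in L_h\times L_h$ satisfy, for $n\ge2$ and all $v_h,w_h\in L_h$, $$(\mathcal{D}_tU_h^{n-\theta},v_h)-\gamma(\nabla \Sigma_h^{n-\theta},\nabla v_h)+(\nabla U_h^{n-\theta},\nabla v_h)+((1-\theta)\mathfrak{F}(U_h^n,u_H^n)+\theta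 f(U_h^{n-1}),v_h)=(g^{n-\theta},v_h),$$ $$(\Sigma_h^{n-\theta},w_h)+(\nabla U_h^{n-\theta},\nabla w_h)=0,$$ and for $n=1$ $$(\mathcal{D}_tU_h^{\frac12},v_h)-\gamma(\nabla \Sigma_h^{\frac12},\nabla v_h)+(\nabla U_h^{\frac12},\nabla v_h)+\tfrac12(\mathfrak{F}(U_h^1,u_H^1)+f(U_h^0),v_h)=(g^{\frac12},v_h),$$ $$(\Sigma_h^{\frac12},w_h)+(\nabla U_h^{\frac12},\nabla w_h)=0.$$
   Formalization: Added because the claim fails without them: f(0)=0; g(·,t) is continuous at t=0 in L²(Ω); and Δt ≤ δ, where δ>0 may depend on g but not on h, H, the finite element spaces, the initial data or the solution. *)

theory Defs
  imports "HOL-Analysis.Analysis"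
begin

text \<open>The Lebesgue space of square integrable functions on \<open>\<Omega>\<close>, with functions (not classes) as
  elements; values outside \<open>\<Omega>\<close> are irrelevant.  Scalar functions are covered by \<open>'b = real\<close>, where the
  inner product is multiplication, and gradient fields by \<open>'b = 'a\<close>.\<close>

definition L2 :: "'a::euclidean_space set \<Rightarrow> ('a \<Rightarrow> 'b::euclidean_space) set" where
  "L2 \<Omega> = {u. u \<in> borel_measurable (lebesgue_on \<Omega>) \<and>
               integrable (lebesgue_on \<Omega>) (\<lambda>x. (norm (u x))\<^sup>2)}"

definition l2_inner :: "'a::euclidean_space set \<Rightarrow> ('a \<Rightarrow> 'b::euclidean_space) \<Rightarrow> ('a \<Rightarrow> 'b) \<Rightarrow> real" where
  "l2_inner \<Omega> u v = integral\<^sup>L (lebesgue_on \<Omega>) (\<lambda>x. u x \<bullet> v x)"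

definition l2_norm :: "'a::euclidean_space set \<Rightarrow> ('a \<Rightarrow> 'b::euclidean_space) \<Rightarrow> real" where
  "l2_norm \<Omega> u = sqrt (l2_inner \<Omega> u u)"

primrec Ck :: "nat \<Rightarrow> ('a::euclidean_space \<Rightarrow> real) \<Rightarrow> bool" where
  "Ck 0 \<phi> = continuous_on UNIV \<phi>"
| "Ck (Suc k) \<phi> = (\<exists>D. (\<forall>x. GDERIV \<phi> x :> D x) \<and> (\<forall>i\<in>Basis. Ck k (\<lambda>x. D x \<bullet> i)))"

definition grad :: "('a::euclidean_space \<Rightarrow> real) \<Rightarrow> 'a \<Rightarrow> 'a" where
  "grad \<phi> x = (THE D. GDERIV \<phi> x :> D)"

definition test_function :: "'a::euclidean_space set \<Rightarrow> ('a \<Rightarrow> real) \<Rightarrow> bool" where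
  "test_function \<Omega> \<phi> \<longleftrightarrow> (\<forall>k. Ck k \<phi>) \<and>
     compact (closure {x. \<phi> x \<noteq> 0}) \<and> closure {x. \<phi> x \<noteq> 0} \<subseteq> \<Omega>"

definition is_weak_grad :: "'a::euclidean_space set \<Rightarrow> ('a \<Rightarrow> real) \<Rightarrow> ('a \<Rightarrow> 'a) \<Rightarrow> bool" where
  "is_weak_grad \<Omega> u G \<longleftrightarrow> G \<in> L2 \<Omega> \<and>
     (\<forall>\<phi>. test_function \<Omega> \<phi> \<longrightarrow>
        integral\<^sup>L (lebesgue_on \<Omega>) (\<lambda>x. u x *\<^sub>R grad \<phi> x) =
        - integral\<^sup>L (lebesgue_on \<Omega>) (\<lambda>x. \<phi> x *\<^sub>R G x))"

text \<open>A weak gradient is unique up to null sets, so for \<open>u\<close> in \<open>H1 \<Omega>\<close> the integrals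
  below do not depend on the representative chosen here.\<close>

definition weak_grad :: "'a::euclidean_space set \<Rightarrow> ('a \<Rightarrow> real) \<Rightarrow> 'a \<Rightarrow> 'a" where
  "weak_grad \<Omega> u = (SOME G. is_weak_grad \<Omega> u G)"

definition H1 :: "'a::euclidean_space set \<Rightarrow> ('a \<Rightarrow> real) set" where
  "H1 \<Omega> = {u \<in> L2 \<Omega>. \<exists>G. is_weak_grad \<Omega> u G}"

text \<open>\<open>H10 \<Omega>\<close> is the closure of the test functions in the norm of \<open>H1 \<Omega>\<close>.\<close>

definition H10 :: "'a::euclidean_space set \<Rightarrow> ('a \<Rightarrow> real) set" where
  "H10 \<Omega> = {u \<in> H1 \<Omega>. \<forall>\<epsilon>>0. \<exists>\<phi>. test_function \<Omega> \<phi> \<and>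
     (l2_norm \<Omega> (\<lambda>x. u x - \<phi> x))\<^sup>2 + (l2_norm \<Omega> (\<lambda>x. weak_grad \<Omega> u x - grad \<phi> x))\<^sup>2 < \<epsilon>\<^sup>2}"

definition convex_polygonal_domain :: "'a::euclidean_space set \<Rightarrow> bool" where
  "convex_polygonal_domain \<Omega> \<longleftrightarrow> \<Omega> \<noteq> {} \<and> open \<Omega> \<and> convex \<Omega> \<and> polytope (closure \<Omega>)"

definition mesh :: "'a::euclidean_space set \<Rightarrow> real \<Rightarrow> 'a set set \<Rightarrow> bool" where
  "mesh \<Omega> h \<T> \<longleftrightarrow> finite \<T> \<and> \<T> \<noteq> {} \<and> (\<forall>K\<in>\<T>. polytope K \<and> interior K \<noteq> {}) \<and>
     (\<forall>K\<in>\<T>. \<forall>K'\<in>\<T>. K \<noteq> K' \<longrightarrow> interior K \<inter> interior K' = {}) \<and>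
     \<Union>\<T> = closure \<Omega> \<and> h = Max (diameter ` \<T>)"

text \<open>A conforming finite element space: a finite-dimensional linear space of \<open>H10\<close> functions that are
  piecewise polynomial on a mesh.  Neither the polynomial degree nor the shape of the (convex) cells is
  fixed, so simplicial as well as rectangular elements are covered.\<close>

definition fe_space :: "'a::euclidean_space set \<Rightarrow> real \<Rightarrow> ('a \<Rightarrow> real) set \<Rightarrow> bool" where
  "fe_space \<Omega> h V \<longleftrightarrow>
     V \<subseteq> H10 \<Omega> \<and>
     (\<lambda>x. 0) \<in> V \<and>
     (\<forall>u\<in>V. \<forall>v\<in>V. (\<lambda>x. u x + v x) \<in> V) \<and> (\<forall>c. \<forall>v\<in>V. (\<lambda>x. c * v x) \<in> V) \<and>
     (\<exists>B. finite B \<and> B \<subseteq> V \<and> (\<forall>v\<in>V. \<exists>c. v = (\<lambda>x. \<Sum>b\<in>B. c b * b x))) \<and>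
     (\<exists>\<T>. mesh \<Omega> h \<T> \<and>
        (\<forall>v\<in>V. \<forall>K\<in>\<T>. \<exists>p. real_polynomial_function p \<and> (\<forall>x\<in>K. v x = p x)))"

text \<open>\<open>dt \<theta> \<tau> \<phi> n\<close> and \<open>av \<theta> \<phi> n\<close> stand for the difference quotient and the average of \<open>\<phi>\<close> at level
  \<open>n - \<theta>\<close> (for \<open>n \<ge> 2\<close>); \<open>dt1\<close> and \<open>av1\<close> are their first-step versions at level \<open>1/2\<close>.\<close>

definition dt :: "real \<Rightarrow> real \<Rightarrow> (nat \<Rightarrow> 'a \<Rightarrow> real) \<Rightarrow> nat \<Rightarrow> 'a \<Rightarrow> real" where
  "dt \<theta> \<tau> \<phi> n = (\<lambda>x. ((3 - 2*\<theta>) * \<phi> n x - (4 - 4*\<theta>) * \<phi> (n-1) x + (1 - 2*\<theta>) * \<phi> (n-2) x) / (2*\<tau>))"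

definition av :: "real \<Rightarrow> (nat \<Rightarrow> 'a \<Rightarrow> real) \<Rightarrow> nat \<Rightarrow> 'a \<Rightarrow> real" where
  "av \<theta> \<phi> n = (\<lambda>x. (1 - \<theta>) * \<phi> n x + \<theta> * \<phi> (n-1) x)"

definition dt1 :: "real \<Rightarrow> (nat \<Rightarrow> 'a \<Rightarrow> real) \<Rightarrow> 'a \<Rightarrow> real" where
  "dt1 \<tau> \<phi> = (\<lambda>x. (\<phi> 1 x - \<phi> 0 x) / \<tau>)"

definition av1 :: "(nat \<Rightarrow> 'a \<Rightarrow> real) \<Rightarrow> 'a \<Rightarrow> real" where
  "av1 \<phi> = (\<lambda>x. (\<phi> 1 x + \<phi> 0 x) / 2)"

text \<open>The pair of equations common to all steps: \<open>du\<close> is the difference quotient, \<open>u\<close> and \<open>s\<close> the averages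
  of the two unknowns, \<open>F\<close> the (possibly linearized) nonlinear term and \<open>G\<close> the source.\<close>

definition mixed_eqs ::
  "'a::euclidean_space set \<Rightarrow> real \<Rightarrow> ('a \<Rightarrow> real) set \<Rightarrow>
   ('a \<Rightarrow> real) \<Rightarrow> ('a \<Rightarrow> real) \<Rightarrow> ('a \<Rightarrow> real) \<Rightarrow> ('a \<Rightarrow> real) \<Rightarrow> ('a \<Rightarrow> real) \<Rightarrow> bool" where
  "mixed_eqs \<Omega> \<gamma> V du u s F G \<longleftrightarrow>
     (\<forall>v\<in>V. l2_inner \<Omega> du v - \<gamma> * l2_inner \<Omega> (weak_grad \<Omega> s) (weak_grad \<Omega> v)
              + l2_inner \<Omega> (weak_grad \<Omega> u) (weak_grad \<Omega> v) + l2_inner \<Omega> F v = l2_inner \<Omega> G v) \<and>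
     (\<forall>w\<in>V. l2_inner \<Omega> s w + l2_inner \<Omega> (weak_grad \<Omega> u) (weak_grad \<Omega> w) = 0)"

definition coarse_solution ::
  "'a::euclidean_space set \<Rightarrow> real \<Rightarrow> real \<Rightarrow> (real \<Rightarrow> real) \<Rightarrow> real \<Rightarrow> nat \<Rightarrow> (nat \<Rightarrow> 'a \<Rightarrow> real) \<Rightarrow>
   ('a \<Rightarrow> real) set \<Rightarrow> (nat \<Rightarrow> 'a \<Rightarrow> real) \<Rightarrow> (nat \<Rightarrow> 'a \<Rightarrow> real) \<Rightarrow> bool" where
  "coarse_solution \<Omega> \<gamma> \<theta> f \<tau> N g V u s \<longleftrightarrow>
     (\<forall>n\<le>N. u n \<in> V \<and> s n \<in> V) \<and>
     (1 \<le> N \<longrightarrow> mixed_eqs \<Omega> \<gamma> V (dt1 \<tau> u) (av1 u) (av1 s) (av1 (\<lambda>n x. f (u n x))) (av1 g)) \<and>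
     (\<forall>n\<in>{2..N}. mixed_eqs \<Omega> \<gamma> V (dt \<theta> \<tau> u n) (av \<theta> u n) (av \<theta> s n)
                    (av \<theta> (\<lambda>n x. f (u n x)) n) (av \<theta> g n))"

definition linearized :: "(real \<Rightarrow> real) \<Rightarrow> ('a \<Rightarrow> real) \<Rightarrow> ('a \<Rightarrow> real) \<Rightarrow> 'a \<Rightarrow> real" where
  "linearized f U u = (\<lambda>x. f (u x) + deriv f (u x) * (U x - u x))"

text \<open>Only the newest time level is linearized, about the coarse solution \<open>u\<close>.\<close>

definition fine_solution ::
  "'a::euclidean_space set \<Rightarrow> real \<Rightarrow> real \<Rightarrow> (real \<Rightarrow> real) \<Rightarrow> real \<Rightarrow> nat \<Rightarrow> (nat \<Rightarrow> 'a \<Rightarrow> real) \<Rightarrow>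
   (nat \<Rightarrow> 'a \<Rightarrow> real) \<Rightarrow> ('a \<Rightarrow> real) set \<Rightarrow> (nat \<Rightarrow> 'a \<Rightarrow> real) \<Rightarrow> (nat \<Rightarrow> 'a \<Rightarrow> real) \<Rightarrow> bool" where
  "fine_solution \<Omega> \<gamma> \<theta> f \<tau> N g u V U S \<longleftrightarrow>
     (\<forall>n\<le>N. U n \<in> V \<and> S n \<in> V) \<and>
     (1 \<le> N \<longrightarrow> mixed_eqs \<Omega> \<gamma> V (dt1 \<tau> U) (av1 U) (av1 S)
        (\<lambda>x. (linearized f (U 1) (u 1) x + f (U 0 x)) / 2) (av1 g)) \<and>
     (\<forall>n\<in>{2..N}. mixed_eqs \<Omega> \<gamma> V (dt \<theta> \<tau> U n) (av \<theta> U n) (av \<theta> S n)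
        (\<lambda>x. (1 - \<theta>) * linearized f (U n) (u n) x + \<theta> * f (U (n-1) x)) (av \<theta> g n))"

end

theory Submission
  imports Defs
begin

text \<open>Testing each pair of equations with the averaged unknowns makes the two mixed gradient terms
  combine to \<open>\<gamma>\<close> times the squared norm of the averaged \<open>\<sigma>\<close>, while G-stability of the difference
  quotient bounds its contribution below by the increment of a quadratic energy.  Since \<open>\<bar>f'\<bar> \<le> L\<close>,
  both nonlinear terms are controlled linearly by the discrete solutions.  Summing the coarse and the
  fine energies closes the estimate, so a single discrete Gronwall argument suffices.  The first step
  involves \<open>g 0\<close>, which is absent from the right-hand side; continuity of \<open>g\<close> at \<open>0\<close> bounds it by
  \<open>g \<tau>\<close> for small \<open>\<tau>\<close>, and this is why \<open>\<delta>\<close> depends on \<open>g\<close>.\<close>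

lemma L2_add:
  fixes u v :: "'a::euclidean_space \<Rightarrow> real"
  assumes "u \<in> L2 \<Omega>" "v \<in> L2 \<Omega>"
  shows "(\<lambda>x. u x + v x) \<in> L2 \<Omega>"
proof -
  have m: "u \<in> borel_measurable (lebesgue_on \<Omega>)" "v \<in> borel_measurable (lebesgue_on \<Omega>)"
    and i: "integrable (lebesgue_on \<Omega>) (\<lambda>x. (u x)\<^sup>2)" "integrable (lebesgue_on \<Omega>) (\<lambda>x. (v x)\<^sup>2)"
    using assms by (auto simp: L2_def)
  have "integrable (lebesgue_on \<Omega>) (\<lambda>x. 2 * (u x)\<^sup>2 + 2 * (v x)\<^sup>2)"
    using i by simp
  then have "integrable (lebesgue_on \<Omega>) (\<lambda>x. (u x + v x)\<^sup>2)"
  proof (rule Bochner_Integration.integrable_bound)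
    show "(\<lambda>x. (u x + v x)\<^sup>2) \<in> borel_measurable (lebesgue_on \<Omega>)"
      using m by measurable
    have "(a + b)\<^sup>2 \<le> 2 * a\<^sup>2 + 2 * b\<^sup>2" for a b :: real
      using zero_le_power2[of "a - b"] by (simp add: power2_eq_square algebra_simps)
    then show "AE x in lebesgue_on \<Omega>. norm ((u x + v x)\<^sup>2) \<le> norm (2 * (u x)\<^sup>2 + 2 * (v x)\<^sup>2)"
      by (intro AE_I2) simp
  qed
  with m show ?thesis
    by (simp add: L2_def)
qed

lemma L2_cmult:
  fixes u :: "'a::euclidean_space \<Rightarrow> real"
  assumes "u \<in> L2 \<Omega>"
  shows "(\<lambda>x. c * u x) \<in> L2 \<Omega>"
  using assms by (auto simp: L2_def power_mult_distrib)

lemma L2_square_integrable: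
  fixes u :: "'a::euclidean_space \<Rightarrow> real"
  assumes "u \<in> L2 \<Omega>"
  shows "integrable (lebesgue_on \<Omega>) (\<lambda>x. (u x)\<^sup>2)"
  using assms by (auto simp: L2_def)

text \<open>Polarization: the product is half of
  \<open>(u x + v x)\<^sup>2 - (u x)\<^sup>2 - (v x)\<^sup>2\<close>, and each of these squares is
  integrable.\<close>

lemma L2_mult_integrable:
  fixes u v :: "'a::euclidean_space \<Rightarrow> real"
  assumes "u \<in> L2 \<Omega>" "v \<in> L2 \<Omega>"
  shows "integrable (lebesgue_on \<Omega>) (\<lambda>x. u x * v x)"
proof -
  have "integrable (lebesgue_on \<Omega>) (\<lambda>x. ((u x + v x)\<^sup>2 - (u x)\<^sup>2 - (v x)\<^sup>2) / 2)"
    using assms by (intro integrable_divide Bochner_Integration.integrable_diff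
        L2_square_integrable L2_add)
  then show ?thesis
    by (simp add: power2_sum)
qed

lemma l2_norm_nonneg [simp]: "0 \<le> l2_norm \<Omega> u"
  by (simp add: l2_norm_def l2_inner_def)

lemma l2_norm_power2: "(l2_norm \<Omega> u)\<^sup>2 = l2_inner \<Omega> u u"
  by (simp add: l2_norm_def l2_inner_def)

lemma l2_norm_power2_real:
  fixes u :: "'a::euclidean_space \<Rightarrow> real"
  shows "(l2_norm \<Omega> u)\<^sup>2 = integral\<^sup>L (lebesgue_on \<Omega>) (\<lambda>x. (u x)\<^sup>2)"
  unfolding l2_norm_power2 by (simp add: l2_inner_def power2_eq_square)

lemma l2_inner_commute: "l2_inner \<Omega> u v = l2_inner \<Omega> v u"
  by (simp add: l2_inner_def inner_commute)

lemma fe_space_L2: "fe_space \<Omega> h V \<Longrightarrow> V \<subseteq> L2 \<Omega>"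
  by (auto simp: fe_space_def H10_def H1_def)

lemma fe_space_lincomb:
  assumes "fe_space \<Omega> h V" "u \<in> V" "v \<in> V"
  shows "(\<lambda>x. a * u x + b * v x) \<in> V"
  using assms unfolding fe_space_def by simp

text \<open>No measurability of \<open>F\<close> is needed: otherwise the Bochner integral is \<open>0\<close>.\<close>

lemma abs_integral_le:
  fixes F B :: "'a \<Rightarrow> real"
  assumes "integrable M B" "\<And>x. \<bar>F x\<bar> \<le> B x"
  shows "\<bar>integral\<^sup>L M F\<bar> \<le> integral\<^sup>L M B"
proof (cases "integrable M F")
  case True
  have "\<bar>integral\<^sup>L M F\<bar> \<le> integral\<^sup>L M (\<lambda>x. \<bar>F x\<bar>)"
    by (rule integral_abs_bound)
  also have "\<dots> \<le> integral\<^sup>L M B"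
    using True assms by (intro integral_mono) auto
  finally show ?thesis .
next
  case False
  have "0 \<le> B x" for x
    using assms(2)[of x] by linarith
  then have "0 \<le> integral\<^sup>L M B"
    by simp
  with False show ?thesis
    by (simp add: not_integrable_integral_eq)
qed

text \<open>Pointwise Young inequalities reduce both pairings to integrals of squares. In the
  applications \<open>p\<close> and \<open>q\<close> are the solution on one grid at the newer and
  older level, \<open>r\<close> is the solution on the other grid at the newer level, and
  \<open>a\<close>, \<open>b\<close> are the source at the two levels.\<close>

lemma load_bound:
  fixes p q r a b v F G :: "'a::euclidean_space \<Rightarrow> real"
  assumes L2: "p \<in> L2 \<Omega>" "q \<in> L2 \<Omega>" "r \<in> L2 \<Omega>" "a \<in> L2 \<Omega>" "b \<in> L2 \<Omega>"
    and M: "0 \<le> M"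
    and F: "\<And>x. \<bar>F x\<bar> \<le> M * (\<bar>p x\<bar> + \<bar>q x\<bar> + \<bar>r x\<bar>)"
    and G: "\<And>x. \<bar>G x\<bar> \<le> \<bar>a x\<bar> + \<bar>b x\<bar>"
    and v: "\<And>x. \<bar>v x\<bar> \<le> \<bar>p x\<bar> + \<bar>q x\<bar>"
  shows "l2_inner \<Omega> G v - l2_inner \<Omega> F v \<le> (3 * M + 1) *
    ((l2_norm \<Omega> p)\<^sup>2 + (l2_norm \<Omega> q)\<^sup>2 + (l2_norm \<Omega> r)\<^sup>2 + (l2_norm \<Omega> a)\<^sup>2 + (l2_norm \<Omega> b)\<^sup>2)"
proof -
  note int = L2[THEN L2_square_integrable]
  have Fv: "\<bar>F x * v x\<bar> \<le> 3 * M * ((p x)\<^sup>2 + (q x)\<^sup>2 + (r x)\<^sup>2)" for x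
  proof -
    have "\<bar>F x * v x\<bar> \<le> (M * (\<bar>p x\<bar> + \<bar>q x\<bar> + \<bar>r x\<bar>)) * (\<bar>p x\<bar> + \<bar>q x\<bar> + \<bar>r x\<bar>)"
      unfolding abs_mult using F[of x] order_trans[OF v[of x], of "\<bar>p x\<bar> + \<bar>q x\<bar> + \<bar>r x\<bar>"] M
      by (intro mult_mono) auto
    also have "\<dots> = M * (\<bar>p x\<bar> + \<bar>q x\<bar> + \<bar>r x\<bar>)\<^sup>2"
      by (simp add: power2_eq_square)
    also have "\<dots> \<le> M * (3 * ((p x)\<^sup>2 + (q x)\<^sup>2 + (r x)\<^sup>2))"
    proof -
      have "(y + z + w)\<^sup>2 \<le> 3 * (y\<^sup>2 + z\<^sup>2 + w\<^sup>2)" for y z w :: real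
        using zero_le_power2[of "y - z"] zero_le_power2[of "y - w"] zero_le_power2[of "z - w"]
        by (simp add: power2_eq_square algebra_simps)
      from this[of "\<bar>p x\<bar>" "\<bar>q x\<bar>" "\<bar>r x\<bar>"] M show ?thesis
        by (simp add: mult_left_mono)
    qed
    finally show ?thesis by (simp add: mult_ac)
  qed
  have Gv: "\<bar>G x * v x\<bar> \<le> (p x)\<^sup>2 + (q x)\<^sup>2 + (a x)\<^sup>2 + (b x)\<^sup>2" for x
  proof -
    have "\<bar>G x * v x\<bar> \<le> (\<bar>a x\<bar> + \<bar>b x\<bar>) * (\<bar>p x\<bar> + \<bar>q x\<bar>)"
      unfolding abs_mult using G[of x] v[of x] by (intro mult_mono) auto
    also have "\<dots> \<le> (p x)\<^sup>2 + (q x)\<^sup>2 + (a x)\<^sup>2 + (b x)\<^sup>2"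
    proof -
      have "(y + z) * (w + w') \<le> w\<^sup>2 + w'\<^sup>2 + y\<^sup>2 + z\<^sup>2" for y z w w' :: real
        using zero_le_power2[of "y - w"] zero_le_power2[of "y - w'"]
          zero_le_power2[of "z - w"] zero_le_power2[of "z - w'"]
        by (simp add: power2_eq_square algebra_simps)
      from this[of "\<bar>a x\<bar>" "\<bar>b x\<bar>" "\<bar>p x\<bar>" "\<bar>q x\<bar>"] show ?thesis
        by simp
    qed
    finally show ?thesis .
  qed
  let ?I = "\<lambda>u. integral\<^sup>L (lebesgue_on \<Omega>) (\<lambda>x. (u x :: real)\<^sup>2)"
  have "\<bar>l2_inner \<Omega> F v\<bar> \<le> integral\<^sup>L (lebesgue_on \<Omega>) (\<lambda>x. 3 * M * ((p x)\<^sup>2 + (q x)\<^sup>2 + (r x)\<^sup>2))"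
    unfolding l2_inner_def using int Fv by (intro abs_integral_le) auto
  also have "\<dots> = 3 * M * (?I p + ?I q + ?I r)"
    using int by simp
  finally have 1: "\<bar>l2_inner \<Omega> F v\<bar> \<le> 3 * M * (?I p + ?I q + ?I r)" .
  have "\<bar>l2_inner \<Omega> G v\<bar> \<le>
      integral\<^sup>L (lebesgue_on \<Omega>) (\<lambda>x. (p x)\<^sup>2 + (q x)\<^sup>2 + (a x)\<^sup>2 + (b x)\<^sup>2)"
    unfolding l2_inner_def using int Gv by (intro abs_integral_le) auto
  also have "\<dots> = ?I p + ?I q + ?I a + ?I b"
    using int by simp
  finally have 2: "\<bar>l2_inner \<Omega> G v\<bar> \<le> ?I p + ?I q + ?I a + ?I b" .
  have "3 * M * (y + z + w) + (y + z + s + t) \<le> (3 * M + 1) * (y + z + w + s + t)"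
    if "0 \<le> w" "0 \<le> s" "0 \<le> t" for y z w s t :: real
    using that M mult_nonneg_nonneg[of M s] mult_nonneg_nonneg[of M t] by (simp add: algebra_simps)
  from this[of "?I r" "?I a" "?I b" "?I p" "?I q"] 1 2 show ?thesis
    unfolding l2_norm_power2_real by (simp add: abs_le_iff)
qed

text \<open>Taking \<open>v = u\<close> in the first equation and \<open>w = s\<close> in the second
  gives an identity whose right-hand side is exactly the quantity that \<open>load_bound\<close>
  estimates.\<close>

lemma step_estimate:
  fixes p q r a b :: "'a::euclidean_space \<Rightarrow> real"
  assumes eqs: "mixed_eqs \<Omega> \<gamma> V du u s F G" "u \<in> V" "s \<in> V"
    and load: "p \<in> L2 \<Omega>" "q \<in> L2 \<Omega>" "r \<in> L2 \<Omega>" "a \<in> L2 \<Omega>" "b \<in> L2 \<Omega>" "0 \<le> M"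
      "\<And>x. \<bar>F x\<bar> \<le> M * (\<bar>p x\<bar> + \<bar>q x\<bar> + \<bar>r x\<bar>)"
      "\<And>x. \<bar>G x\<bar> \<le> \<bar>a x\<bar> + \<bar>b x\<bar>" "\<And>x. \<bar>u x\<bar> \<le> \<bar>p x\<bar> + \<bar>q x\<bar>"
  shows "l2_inner \<Omega> du u + \<gamma> * (l2_norm \<Omega> s)\<^sup>2 + (l2_norm \<Omega> (weak_grad \<Omega> u))\<^sup>2 \<le> (3 * M + 1) *
    ((l2_norm \<Omega> p)\<^sup>2 + (l2_norm \<Omega> q)\<^sup>2 + (l2_norm \<Omega> r)\<^sup>2 + (l2_norm \<Omega> a)\<^sup>2 + (l2_norm \<Omega> b)\<^sup>2)"
proof -
  have "l2_inner \<Omega> du u - \<gamma> * l2_inner \<Omega> (weak_grad \<Omega> s) (weak_grad \<Omega> u)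
      + l2_inner \<Omega> (weak_grad \<Omega> u) (weak_grad \<Omega> u) + l2_inner \<Omega> F u = l2_inner \<Omega> G u"
    and s: "l2_inner \<Omega> s s + l2_inner \<Omega> (weak_grad \<Omega> u) (weak_grad \<Omega> s) = 0"
    using eqs unfolding mixed_eqs_def by blast+
  moreover have "l2_inner \<Omega> (weak_grad \<Omega> s) (weak_grad \<Omega> u) = - l2_inner \<Omega> s s"
    using s l2_inner_commute[of \<Omega> "weak_grad \<Omega> s"] by simp
  ultimately have "l2_inner \<Omega> du u + \<gamma> * (l2_norm \<Omega> s)\<^sup>2 + (l2_norm \<Omega> (weak_grad \<Omega> u))\<^sup>2
      = l2_inner \<Omega> G u - l2_inner \<Omega> F u"
    by (simp add: l2_norm_power2)
  also note load_bound[OF load]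
  finally show ?thesis .
qed

text \<open>The quadratic form of the G-norm of the scheme, with \<open>a\<close> the newer value.
  At \<theta> = 0 it is the BDF2 energy \<open>a\<^sup>2 + (2 * a - b)\<^sup>2\<close>, at \<theta>
  = 1/2 the Crank-Nicolson energy \<open>2 * a\<^sup>2\<close>.\<close>

definition gform :: "real \<Rightarrow> real \<Rightarrow> real \<Rightarrow> real" where
  "gform \<theta> a b = (3 - 2*\<theta>) * a\<^sup>2 - (1 - 2*\<theta>) * b\<^sup>2 + (2 - \<theta>) * (1 - 2*\<theta>) * (a - b)\<^sup>2"

text \<open>G-stability: the product exceeds the increment of the form by a multiple of the squared
  second difference, and the factor \<open>(1 - \<theta>) * (1 - 2*\<theta>)\<close> is nonnegative
  for \<theta> in [0, 1/2].\<close>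

lemma gform_diff_le:
  assumes "0 \<le> \<theta>" "\<theta> \<le> 1/2"
  shows "gform \<theta> a b - gform \<theta> b c
    \<le> 2 * (((3 - 2*\<theta>) * a - (4 - 4*\<theta>) * b + (1 - 2*\<theta>) * c) * ((1 - \<theta>) * a + \<theta> * b))"
proof -
  have "2 * (((3 - 2*\<theta>) * a - (4 - 4*\<theta>) * b + (1 - 2*\<theta>) * c) * ((1 - \<theta>) * a + \<theta> * b))
      = gform \<theta> a b - gform \<theta> b c + (1 - \<theta>) * (1 - 2*\<theta>) * (a - 2*b + c)\<^sup>2"
    unfolding gform_def by algebra
  moreover have "0 \<le> (1 - \<theta>) * (1 - 2*\<theta>) * (a - 2*b + c)\<^sup>2"
    using assms by simp
  ultimately show ?thesis by linarith
qed

text \<open>Multiplying the gap by the positive number \<open>1 - \<theta>\<close> completes the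
  square, which leaves a sum of two nonnegative terms.\<close>

lemma gform_ge:
  assumes "0 \<le> \<theta>" "\<theta> \<le> 1/2"
  shows "a\<^sup>2 \<le> gform \<theta> a b"
proof -
  have "(1 - \<theta>) * (gform \<theta> a b - a\<^sup>2) = \<theta> * a\<^sup>2 + (1 - 2*\<theta>) * ((2 - \<theta>) * a - (1 - \<theta>) * b)\<^sup>2"
    unfolding gform_def by algebra
  moreover have "0 \<le> \<theta> * a\<^sup>2 + (1 - 2*\<theta>) * ((2 - \<theta>) * a - (1 - \<theta>) * b)\<^sup>2"
    using assms by simp
  ultimately have "0 \<le> (1 - \<theta>) * (gform \<theta> a b - a\<^sup>2)"
    by simp
  then show ?thesis
    using assms by (simp add: zero_le_mult_iff)
qed

lemma gform_le:
  assumes "0 \<le> \<theta>" "\<theta> \<le> 1/2"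
  shows "gform \<theta> a b \<le> 10 * (a\<^sup>2 + b\<^sup>2)"
proof -
  have "(2 - \<theta>) * (1 - 2*\<theta>) \<le> 2 * 1"
    using assms by (intro mult_mono) auto
  then have "(2 - \<theta>) * (1 - 2*\<theta>) * (a - b)\<^sup>2 \<le> 2 * (a - b)\<^sup>2"
    by (intro mult_right_mono) auto
  also have "\<dots> \<le> 4 * (a\<^sup>2 + b\<^sup>2)"
    using zero_le_power2[of "a + b"] by (simp add: power2_eq_square algebra_simps)
  finally have "(2 - \<theta>) * (1 - 2*\<theta>) * (a - b)\<^sup>2 \<le> 4 * (a\<^sup>2 + b\<^sup>2)" .
  moreover have "(3 - 2*\<theta>) * a\<^sup>2 \<le> 3 * a\<^sup>2" "0 \<le> (1 - 2*\<theta>) * b\<^sup>2"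
    using assms by (auto intro: mult_right_mono)
  ultimately have "gform \<theta> a b \<le> 3 * a\<^sup>2 - 0 + 4 * (a\<^sup>2 + b\<^sup>2)"
    unfolding gform_def by (intro add_mono diff_mono)
  also have "\<dots> \<le> 10 * (a\<^sup>2 + b\<^sup>2)"
    by simp
  finally show ?thesis .
qed

definition energy :: "'a::euclidean_space set \<Rightarrow> real \<Rightarrow> ('a \<Rightarrow> real) \<Rightarrow> ('a \<Rightarrow> real) \<Rightarrow> real" where
  "energy \<Omega> \<theta> u v = integral\<^sup>L (lebesgue_on \<Omega>) (\<lambda>x. gform \<theta> (u x) (v x))"

lemma gform_integrable:
  assumes "u \<in> L2 \<Omega>" "v \<in> L2 \<Omega>"
  shows "integrable (lebesgue_on \<Omega>) (\<lambda>x. gform \<theta> (u x) (v x))"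
proof -
  have "integrable (lebesgue_on \<Omega>) (\<lambda>x. (u x + -1 * v x)\<^sup>2)"
    using assms by (intro L2_square_integrable L2_add L2_cmult)
  then show ?thesis
    unfolding gform_def using assms[THEN L2_square_integrable] by simp
qed

lemma energy_ge:
  assumes "0 \<le> \<theta>" "\<theta> \<le> 1/2" "u \<in> L2 \<Omega>" "v \<in> L2 \<Omega>"
  shows "(l2_norm \<Omega> u)\<^sup>2 \<le> energy \<Omega> \<theta> u v"
  unfolding l2_norm_power2_real energy_def using assms
  by (intro integral_mono gform_integrable L2_square_integrable gform_ge)

lemma energy_le:
  assumes "0 \<le> \<theta>" "\<theta> \<le> 1/2" "u \<in> L2 \<Omega>" "v \<in> L2 \<Omega>"
  shows "energy \<Omega> \<theta> u v \<le> 10 * ((l2_norm \<Omega> u)\<^sup>2 + (l2_norm \<Omega> v)\<^sup>2)"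
proof -
  note int = assms(3,4)[THEN L2_square_integrable]
  have "energy \<Omega> \<theta> u v \<le> integral\<^sup>L (lebesgue_on \<Omega>) (\<lambda>x. 10 * ((u x)\<^sup>2 + (v x)\<^sup>2))"
    unfolding energy_def using assms int by (intro integral_mono gform_integrable gform_le) auto
  also have "\<dots> = 10 * ((l2_norm \<Omega> u)\<^sup>2 + (l2_norm \<Omega> v)\<^sup>2)"
    unfolding l2_norm_power2_real using int by simp
  finally show ?thesis .
qed

text \<open>The integrated form of \<open>gform_diff_le\<close>. The factor
  \<open>4 * \<tau>\<close> is the 2 from there times the denominator \<open>2 * \<tau>\<close> of
  \<open>dt\<close>.\<close>

lemma energy_diff_le:
  assumes \<theta>: "0 \<le> \<theta>" "\<theta> \<le> 1/2" and \<tau>: "0 < \<tau>"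
    and L2: "u n \<in> L2 \<Omega>" "u (n-1) \<in> L2 \<Omega>" "u (n-2) \<in> L2 \<Omega>"
  shows "energy \<Omega> \<theta> (u n) (u (n-1)) - energy \<Omega> \<theta> (u (n-1)) (u (n-2))
    \<le> 4 * \<tau> * l2_inner \<Omega> (dt \<theta> \<tau> u n) (av \<theta> u n)"
proof -
  \<comment> \<open>Subtraction is written as addition of a negative multiple so that
    \<open>L2_add\<close> and \<open>L2_cmult\<close> apply directly.\<close>
  let ?D = "\<lambda>x. (3 - 2*\<theta>) * u n x + - (4 - 4*\<theta>) * u (n-1) x + (1 - 2*\<theta>) * u (n-2) x"
  let ?A = "\<lambda>x. (1 - \<theta>) * u n x + \<theta> * u (n-1) x"
  have "integrable (lebesgue_on \<Omega>) (\<lambda>x. ?D x * ?A x)"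
    using L2 by (intro L2_mult_integrable L2_add L2_cmult)
  then have int: "integrable (lebesgue_on \<Omega>) (\<lambda>x. 2 * (?D x * ?A x))"
    by simp
  have "energy \<Omega> \<theta> (u n) (u (n-1)) - energy \<Omega> \<theta> (u (n-1)) (u (n-2)) =
      integral\<^sup>L (lebesgue_on \<Omega>)
        (\<lambda>x. gform \<theta> (u n x) (u (n-1) x) - gform \<theta> (u (n-1) x) (u (n-2) x))"
    unfolding energy_def using L2
    by (intro Bochner_Integration.integral_diff[symmetric] gform_integrable)
  also have "\<dots> \<le> integral\<^sup>L (lebesgue_on \<Omega>) (\<lambda>x. 2 * (?D x * ?A x))"
  proof (rule integral_mono[OF _ int])
    show "integrable (lebesgue_on \<Omega>)
        (\<lambda>x. gform \<theta> (u n x) (u (n-1) x) - gform \<theta> (u (n-1) x) (u (n-2) x))"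
      using L2 by (intro Bochner_Integration.integrable_diff gform_integrable)
    show "gform \<theta> (u n x) (u (n-1) x) - gform \<theta> (u (n-1) x) (u (n-2) x) \<le> 2 * (?D x * ?A x)" for x
      using gform_diff_le[OF \<theta>, of "u n x" "u (n-1) x" "u (n-2) x"] by (simp add: algebra_simps)
  qed
  also have "(\<lambda>x. 2 * (?D x * ?A x)) = (\<lambda>x. 4 * \<tau> * (dt \<theta> \<tau> u n x * av \<theta> u n x))"
    using \<tau> by (simp add: fun_eq_iff dt_def av_def field_simps)
  finally show ?thesis
    by (simp add: l2_inner_def)
qed

text \<open>Pointwise this is \<open>(a - b) * (a + b) = a\<^sup>2 - b\<^sup>2\<close>. The first
  step has one older level only, so plain norms replace the energy.\<close>

lemma l2_inner_dt1_av1: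
  fixes u :: "nat \<Rightarrow> 'a::euclidean_space \<Rightarrow> real"
  assumes "0 < \<tau>" "u 1 \<in> L2 \<Omega>" "u 0 \<in> L2 \<Omega>"
  shows "2 * \<tau> * l2_inner \<Omega> (dt1 \<tau> u) (av1 u) = (l2_norm \<Omega> (u 1))\<^sup>2 - (l2_norm \<Omega> (u 0))\<^sup>2"
proof -
  have "2 * \<tau> * l2_inner \<Omega> (dt1 \<tau> u) (av1 u)
      = integral\<^sup>L (lebesgue_on \<Omega>) (\<lambda>x. 2 * \<tau> * (dt1 \<tau> u x * av1 u x))"
    by (simp add: l2_inner_def)
  also have "(\<lambda>x. 2 * \<tau> * (dt1 \<tau> u x * av1 u x)) = (\<lambda>x. (u 1 x)\<^sup>2 - (u 0 x)\<^sup>2)"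
    using assms(1) by (simp add: fun_eq_iff dt1_def av1_def field_simps power2_eq_square)
  finally show ?thesis
    unfolding l2_norm_power2_real using assms(2,3)[THEN L2_square_integrable] by simp
qed

text \<open>Solving each step for \<open>P k\<close> costs the factor (1 + x)/(1 - x), which is at
  most 1 + 4x and hence at most exp(4x) when x \<le> 1/2. The source picks up 1/(1 - x) \<le>
  2.\<close>

lemma discrete_gronwall:
  fixes P R :: "nat \<Rightarrow> real"
  assumes x: "0 \<le> x" "x \<le> 1/2" and n: "1 \<le> n"
    and P: "\<And>k. 1 \<le> k \<Longrightarrow> k \<le> n \<Longrightarrow> 0 \<le> P k" and R: "\<And>k. 0 \<le> R k"
    and step: "\<And>k. 2 \<le> k \<Longrightarrow> k \<le> n \<Longrightarrow> P k - P (k-1) \<le> x * (P k + P (k-1) + R k)"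
  shows "P n \<le> exp (4 * x * real n) * (P 1 + 2 * x * (\<Sum>k=2..n. R k))"
  using n P step
proof (induction n rule: nat_induct_at_least)
  case base
  have "1 * P 1 \<le> exp (4 * x) * P 1"
    using x base by (intro mult_right_mono) auto
  then show ?case by simp
next
  case (Suc n)
  let ?B = "P 1 + 2 * x * (\<Sum>k=2..n. R k)"
  have IH: "P n \<le> exp (4 * x * real n) * ?B"
    using Suc by simp
  have Pn: "0 \<le> P n" "0 \<le> P (Suc n)"
    using Suc by simp_all
  have "P (Suc n) - P n \<le> x * (P (Suc n) + P n + R (Suc n))"
    using Suc.prems(2)[of "Suc n"] Suc.hyps by simp
  then have "(1 - x) * P (Suc n) \<le> (1 + x) * P n + x * R (Suc n)"
    by (simp add: algebra_simps)
  \<comment> \<open>The factor \<open>1 - x\<close> is pulled out in order to be cancelled. Both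
    coefficient bounds amount to \<open>0 \<le> x * (1 - 2 * x)\<close>, where x \<le> 1/2
    enters.\<close>
  also have "\<dots> \<le> ((1 - x) * (1 + 4 * x)) * P n + ((1 - x) * (2 * x)) * R (Suc n)"
  proof (intro add_mono mult_right_mono)
    have "0 \<le> x * (1 - 2 * x)"
      using x by simp
    then show "1 + x \<le> (1 - x) * (1 + 4 * x)" "x \<le> (1 - x) * (2 * x)"
      by (simp_all add: algebra_simps)
  qed (use Pn R in auto)
  also have "\<dots> = (1 - x) * ((1 + 4 * x) * P n + 2 * x * R (Suc n))"
    by (simp add: algebra_simps)
  finally have "P (Suc n) \<le> (1 + 4 * x) * P n + 2 * x * R (Suc n)"
    using x by simp
  also have "\<dots> \<le> exp (4 * x) * (exp (4 * x * real n) * ?B)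
      + exp (4 * x * real (Suc n)) * (2 * x * R (Suc n))"
  proof (rule add_mono)
    show "(1 + 4 * x) * P n \<le> exp (4 * x) * (exp (4 * x * real n) * ?B)"
      using IH Pn by (intro mult_mono exp_ge_add_one_self) auto
    \<comment> \<open>The new source term is enlarged by the full exponential so that it joins the
      sum inside the bracket.\<close>
    have "1 * (2 * x * R (Suc n)) \<le> exp (4 * x * real (Suc n)) * (2 * x * R (Suc n))"
      using x R by (intro mult_right_mono) auto
    then show "2 * x * R (Suc n) \<le> exp (4 * x * real (Suc n)) * (2 * x * R (Suc n))"
      by simp
  qed
  also have "exp (4 * x) * (exp (4 * x * real n) * ?B) = exp (4 * x * real (Suc n)) * ?B"
    by (simp add: algebra_simps flip: exp_add)
  also have "exp (4 * x * real (Suc n)) * ?B + exp (4 * x * real (Suc n)) * (2 * x * R (Suc n))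
      = exp (4 * x * real (Suc n)) * (P 1 + 2 * x * (\<Sum>k=2..Suc n. R k))"
    using Suc.hyps by (simp add: algebra_simps)
  finally show ?case .
qed

text \<open>Joins the first step, phrased with the squared norms \<open>q\<close>, to the Gronwall
  bound for the energies \<open>P\<close> from level 1 on. The value \<open>G 0\<close> is traded
  for \<open>G 1\<close>, so the final sum starts at 1.\<close>

lemma energy_sum_bound:
  fixes P G q :: "nat \<Rightarrow> real"
  assumes x: "0 \<le> x" "x \<le> 1/2" and n: "2 \<le> n"
    and G: "\<And>k. 0 \<le> G k" "G 0 \<le> 4 * G 1"
    and q: "0 \<le> q 0" "0 \<le> q 1"
    and first: "q 1 - q 0 \<le> x / 2 * (q 1 + q 0 + G 1 + G 0)"
    and P1: "P 1 \<le> 10 * (q 1 + q 0)"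
    and P: "\<And>k. 1 \<le> k \<Longrightarrow> k \<le> n \<Longrightarrow> 0 \<le> P k"
    and step: "\<And>k. 2 \<le> k \<Longrightarrow> k \<le> n \<Longrightarrow> P k - P (k-1) \<le> x * (P k + P (k-1) + (G k + G (k-1)))"
  shows "P n \<le> exp (4 * x * real n) * (30 * q 0 + 44 * x * (\<Sum>k=1..n. G k))"
proof -
  \<comment> \<open>Since x/2 \<le> 1/4, the term with \<open>q 1\<close> on the right can be
    absorbed on the left.\<close>
  have le: "x / 2 * q 1 \<le> 1/4 * q 1" "x / 2 * q 0 \<le> 1/4 * q 0" "x * G 0 \<le> x * (4 * G 1)"
    using x q G by (intro mult_right_mono mult_left_mono; simp)+
  have xG: "0 \<le> x * G 1"
    using x G by simp
  have "q 1 - q 0 \<le> 1/4 * q 1 + 1/4 * q 0 + 5/2 * (x * G 1)"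
    using first le by (simp add: algebra_simps)
  \<comment> \<open>Absorption leaves the factors 5/3 and 10/3, rounded up to 2 and 4.\<close>
  then have "q 1 \<le> 2 * q 0 + 4 * (x * G 1)"
    using q xG by linarith
  then have 1: "P 1 \<le> 30 * q 0 + 40 * (x * G 1)"
    using P1 by (simp add: algebra_simps)
  have split: "(\<Sum>k=1..n. G k) = G 1 + (\<Sum>k=2..n. G k)"
    using n by (simp add: sum.atLeast_Suc_atMost numeral_2_eq_2)
  have "(\<Sum>k=2..n. G (k-1)) = (\<Sum>k=1..n-1. G k)"
    using n sum.shift_bounds_cl_Suc_ivl[of "\<lambda>k. G (k-1)" 1 "n-1"] by (simp add: numeral_2_eq_2)
  also have "\<dots> \<le> (\<Sum>k=1..n. G k)"
    using G by (intro sum_mono2) auto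
  finally have shift: "(\<Sum>k=2..n. G (k-1)) \<le> (\<Sum>k=1..n. G k)" .
  \<comment> \<open>Each source value occurs at most twice, once as the newer and once as the older
    level.\<close>
  have R: "(\<Sum>k=2..n. G k + G (k-1)) \<le> 2 * (\<Sum>k=1..n. G k)"
    unfolding sum.distrib using shift split G(1)[of 1] by linarith
  have "G 1 \<le> (\<Sum>k=1..n. G k)"
    unfolding split using G by (simp add: sum_nonneg)
  then have 2: "x * G 1 \<le> x * (\<Sum>k=1..n. G k)"
    and 3: "x * (\<Sum>k=2..n. G k + G (k-1)) \<le> x * (2 * (\<Sum>k=1..n. G k))"
    using R x by (auto intro: mult_left_mono)
  have "P n \<le> exp (4 * x * real n) * (P 1 + 2 * x * (\<Sum>k=2..n. G k + G (k-1)))"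
    using x n P G step by (intro discrete_gronwall) (auto intro: add_nonneg_nonneg)
  \<comment> \<open>Of the 44, 40 comes from \<open>P 1\<close> and 4 from the Gronwall factor 2
    times the double counting of the source.\<close>
  also have "\<dots> \<le> exp (4 * x * real n) * (30 * q 0 + 44 * x * (\<Sum>k=1..n. G k))"
    using 1 2 3 by (intro mult_left_mono) auto
  finally show ?thesis .
qed

lemma abs_average_le:
  fixes a b :: real
  assumes "0 \<le> \<theta>" "\<theta> \<le> 1"
  shows "\<bar>(1 - \<theta>) * a + \<theta> * b\<bar> \<le> \<bar>a\<bar> + \<bar>b\<bar>"
proof -
  have "\<bar>(1 - \<theta>) * a + \<theta> * b\<bar> \<le> (1 - \<theta>) * \<bar>a\<bar> + \<theta> * \<bar>b\<bar>"
    using assms abs_triangle_ineq[of "(1 - \<theta>) * a" "\<theta> * b"] by (simp add: abs_mult)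
  also have "\<dots> \<le> 1 * \<bar>a\<bar> + 1 * \<bar>b\<bar>"
    using assms by (intro add_mono mult_right_mono) auto
  finally show ?thesis by simp
qed

text \<open>The derivative is the limit of difference quotients, each of which is bounded by the
  Lipschitz constant.\<close>

lemma abs_deriv_le:
  fixes f :: "real \<Rightarrow> real"
  assumes "f differentiable (at a)" "\<And>b c. \<bar>f b - f c\<bar> \<le> L * \<bar>b - c\<bar>"
  shows "\<bar>deriv f a\<bar> \<le> L"
proof -
  have "(f has_real_derivative deriv f a) (at a)"
    using assms(1) by (simp add: DERIV_deriv_iff_real_differentiable)
  then have "((\<lambda>y. (f y - f a) / (y - a)) \<longlongrightarrow> deriv f a) (at a)"
    by (simp add: has_field_derivative_iff)
  then have "((\<lambda>y. \<bar>(f y - f a) / (y - a)\<bar>) \<longlongrightarrow> \<bar>deriv f a\<bar>) (at a)"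
    by (rule tendsto_rabs)
  moreover have "eventually (\<lambda>y. \<bar>(f y - f a) / (y - a)\<bar> \<le> L) (at a)"
    unfolding eventually_at using assms(2)
    by (intro exI[of _ 1]) (auto simp: divide_simps abs_divide)
  ultimately show ?thesis
    by (intro tendsto_upperbound) auto
qed

theorem theorem3p3:
  fixes \<Omega> :: "(real^'d) set" and T \<gamma> \<theta> L :: real and f :: "real \<Rightarrow> real"
  assumes dim: "CARD('d) \<le> 2"
    and domain: "convex_polygonal_domain \<Omega>"
    and T: "0 < T" and gamma: "0 < \<gamma>" and theta: "0 \<le> \<theta>" "\<theta> \<le> 1/2"
    and f_diff: "\<forall>a. f differentiable (at a)"
    and f_lipschitz: "\<forall>a b. \<bar>f a - f b\<bar> \<le> L * \<bar>a - b\<bar>"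
    and f_zero: "f 0 = 0"
  shows "\<exists>C>0. \<forall>g :: real^'d \<Rightarrow> real \<Rightarrow> real.
    (\<forall>t\<in>{0..T}. (\<lambda>x. g x t) \<in> L2 \<Omega>) \<and>
    ((\<lambda>t. l2_norm \<Omega> (\<lambda>x. g x t - g x 0)) \<longlongrightarrow> 0) (at 0 within {0..T}) \<longrightarrow>
    (\<exists>\<delta>>0. \<forall>(N::nat) \<tau> h H L\<^sub>h L\<^sub>H u \<sigma> U S.
      0 < N \<and> \<tau> = T / real N \<and> \<tau> \<le> \<delta> \<and>
      fe_space \<Omega> h L\<^sub>h \<and> fe_space \<Omega> H L\<^sub>H \<and> L\<^sub>H \<subseteq> L\<^sub>h \<and>
      coarse_solution \<Omega> \<gamma> \<theta> f \<tau> N (\<lambda>n x. g x (real n * \<tau>)) L\<^sub>H u \<sigma> \<and>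
      fine_solution \<Omega> \<gamma> \<theta> f \<tau> N (\<lambda>n x. g x (real n * \<tau>)) u L\<^sub>h U S \<longrightarrow>
      (\<forall>n. 2 \<le> n \<and> n \<le> N \<longrightarrow>
        (l2_norm \<Omega> (U n))\<^sup>2
          + \<tau> * (\<Sum>k=2..n. (l2_norm \<Omega> (weak_grad \<Omega> (av \<theta> U k)))\<^sup>2)
          + \<gamma> * \<tau> * (\<Sum>k=2..n. (l2_norm \<Omega> (av \<theta> S k))\<^sup>2)
        \<le> C * ((l2_norm \<Omega> (U 0))\<^sup>2 + (l2_norm \<Omega> (u 0))\<^sup>2
               + \<tau> * (\<Sum>k=1..n. (l2_norm \<Omega> (\<lambda>x. g x (real k * \<tau>)))\<^sup>2))))"
proof -

  \<comment> \<open>Constants and pointwise bounds for the nonlinear terms\<close>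
  define K where "K = 6 * L + 1"
  have L: "0 \<le> L"
    using f_lipschitz[rule_format, of 1 0] by simp
  then have K: "1 \<le> K"
    by (simp add: K_def)
  have f_le: "\<bar>f a\<bar> \<le> L * \<bar>a\<bar>" for a
    using f_lipschitz[rule_format, of a 0] f_zero by simp
  \<comment> \<open>The linearized term forces the constant \<open>2 * L\<close>: its expansion
    point contributes once through \<open>f\<close> and once through the derivative. The plain term
    is weakened to the same constant, so \<open>step_estimate\<close> is always used with
    \<open>M = 2 * L\<close>, and \<open>K\<close> is \<open>3 * M + 1\<close>.\<close>
  have f_le': "\<bar>f a\<bar> \<le> 2 * L * \<bar>a\<bar>" for a
    using f_le[of a] L mult_nonneg_nonneg[of L "\<bar>a\<bar>"] by linarith
  have lin_le: "\<bar>linearized f W w x\<bar> \<le> 2 * L * (\<bar>W x\<bar> + \<bar>w x\<bar>)"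
    for W w :: "real^'d \<Rightarrow> real" and x
  proof -
    have "\<bar>deriv f (w x) * (W x - w x)\<bar> \<le> L * (\<bar>W x\<bar> + \<bar>w x\<bar>)"
      unfolding abs_mult using abs_deriv_le[of f "w x" L] f_diff f_lipschitz L
      by (intro mult_mono) auto
    moreover have "0 \<le> L * \<bar>W x\<bar>"
      using L by simp
    ultimately show ?thesis
      unfolding linearized_def using f_le[of "w x"] by (simp add: algebra_simps)
  qed
  \<comment> \<open>With \<open>x = 8 * \<tau> * K\<close> below, \<open>4 * x * real n\<close> is
    at most \<open>32 * K * T\<close>, and 352 is 44 times 8. The constant is fixed before
    \<open>g\<close>, the meshes and \<tau> are introduced.\<close>
  define C where "C = exp (32 * K * T) * (30 + 352 * K)"
  have C: "0 < C"
    using K by (simp add: C_def)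
  show ?thesis
  proof (rule exI[of _ C], rule conjI[OF C], intro allI impI)
    fix g :: "real^'d \<Rightarrow> real \<Rightarrow> real"
    assume "(\<forall>t\<in>{0..T}. (\<lambda>x. g x t) \<in> L2 \<Omega>) \<and>
      ((\<lambda>t. l2_norm \<Omega> (\<lambda>x. g x t - g x 0)) \<longlongrightarrow> 0) (at 0 within {0..T})"
    then have gL2: "\<And>t. 0 \<le> t \<Longrightarrow> t \<le> T \<Longrightarrow> (\<lambda>x. g x t) \<in> L2 \<Omega>"
      and glim: "((\<lambda>t. l2_norm \<Omega> (\<lambda>x. g x t - g x 0)) \<longlongrightarrow> 0) (at 0 within {0..T})"
      by auto

    \<comment> \<open>Control of the source at time 0 by its value at a small positive time\<close>
    obtain d where d: "0 < d" and g0: "\<And>t. 0 < t \<Longrightarrow> t < d \<Longrightarrow> t \<le> T \<Longrightarrow>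
        (l2_norm \<Omega> (\<lambda>x. g x 0))\<^sup>2 \<le> 4 * (l2_norm \<Omega> (\<lambda>x. g x t))\<^sup>2"
    proof (cases "l2_norm \<Omega> (\<lambda>x. g x 0) = 0")
      case True
      then show ?thesis
        using that[of 1] by simp
    next
      case False
      \<comment> \<open>With half the norm as tolerance, ||g(0)||^2 \<le> 2 \<epsilon>^2 + 2
        ||g(t)||^2 has ||g(0)||^2 / 2 as its first term on the right. Absorbing that term gives the
        factor 4.\<close>
      define \<epsilon> where "\<epsilon> = l2_norm \<Omega> (\<lambda>x. g x 0) / 2"
      have "0 < \<epsilon>"
        using False l2_norm_nonneg[of \<Omega> "\<lambda>x. g x 0"] by (simp add: \<epsilon>_def del: l2_norm_nonneg)
      then have "eventually (\<lambda>t. dist (l2_norm \<Omega> (\<lambda>x. g x t - g x 0)) 0 < \<epsilon>) (at 0 within {0..T})"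
        using glim by (rule tendstoD[rotated])
      then obtain d where d: "0 < d" and close: "\<And>t. t \<in> {0..T} \<Longrightarrow> t \<noteq> 0 \<Longrightarrow> dist t 0 < d \<Longrightarrow>
          dist (l2_norm \<Omega> (\<lambda>x. g x t - g x 0)) 0 < \<epsilon>"
        unfolding eventually_at by auto
      show ?thesis
      proof (rule that[OF d])
        fix t assume t: "0 < t" "t < d" "t \<le> T"
        let ?e = "\<lambda>x. g x t + -1 * g x 0"
        have e: "?e \<in> L2 \<Omega>" and gt: "(\<lambda>x. g x t) \<in> L2 \<Omega>" and g0': "(\<lambda>x. g x 0) \<in> L2 \<Omega>"
          using t T by (intro L2_add L2_cmult gL2; simp)+
        note int = e[THEN L2_square_integrable] gt[THEN L2_square_integrable]
        have "(l2_norm \<Omega> ?e)\<^sup>2 \<le> \<epsilon>\<^sup>2"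
          using close[of t] t by (intro power_mono) auto
        moreover have "(l2_norm \<Omega> (\<lambda>x. g x 0))\<^sup>2
            \<le> integral\<^sup>L (lebesgue_on \<Omega>) (\<lambda>x. 2 * (?e x)\<^sup>2 + 2 * (g x t)\<^sup>2)"
          unfolding l2_norm_power2_real
        proof (rule integral_mono)
          show "integrable (lebesgue_on \<Omega>) (\<lambda>x. (g x 0)\<^sup>2)"
            using g0' by (rule L2_square_integrable)
          show "integrable (lebesgue_on \<Omega>) (\<lambda>x. 2 * (?e x)\<^sup>2 + 2 * (g x t)\<^sup>2)"
            by (intro Bochner_Integration.integrable_add integrable_mult_right int)
          have "b\<^sup>2 \<le> 2 * (a + -1 * b)\<^sup>2 + 2 * a\<^sup>2" for a b :: real
            using zero_le_power2[of "2 * a - b"] by (simp add: power2_eq_square algebra_simps)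
          then show "(g x 0)\<^sup>2 \<le> 2 * (?e x)\<^sup>2 + 2 * (g x t)\<^sup>2" for x .
        qed
        moreover have "integral\<^sup>L (lebesgue_on \<Omega>) (\<lambda>x. 2 * (?e x)\<^sup>2 + 2 * (g x t)\<^sup>2)
            = 2 * (l2_norm \<Omega> ?e)\<^sup>2 + 2 * (l2_norm \<Omega> (\<lambda>x. g x t))\<^sup>2"
          unfolding l2_norm_power2_real
          by (subst Bochner_Integration.integral_add) (use int in auto)
        moreover have "4 * \<epsilon>\<^sup>2 = (l2_norm \<Omega> (\<lambda>x. g x 0))\<^sup>2"
          by (simp add: \<epsilon>_def power_divide)
        ultimately show "(l2_norm \<Omega> (\<lambda>x. g x 0))\<^sup>2 \<le> 4 * (l2_norm \<Omega> (\<lambda>x. g x t))\<^sup>2"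
          by linarith
      qed
    qed
    \<comment> \<open>The first bound ensures \<tau> < \<open>d\<close>, the second that
      \<open>x = 8 * \<tau> * K\<close> is at most 1/2, as Gronwall requires.\<close>
    define \<delta> where "\<delta> = min (d / 2) (1 / (16 * K))"
    have \<delta>: "0 < \<delta>"
      using d K by (simp add: \<delta>_def)
    show "\<exists>\<delta>>0. \<forall>(N::nat) \<tau> h H L\<^sub>h L\<^sub>H u \<sigma> U S.
      0 < N \<and> \<tau> = T / real N \<and> \<tau> \<le> \<delta> \<and>
      fe_space \<Omega> h L\<^sub>h \<and> fe_space \<Omega> H L\<^sub>H \<and> L\<^sub>H \<subseteq> L\<^sub>h \<and>
      coarse_solution \<Omega> \<gamma> \<theta> f \<tau> N (\<lambda>n x. g x (real n * \<tau>)) L\<^sub>H u \<sigma> \<and>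
      fine_solution \<Omega> \<gamma> \<theta> f \<tau> N (\<lambda>n x. g x (real n * \<tau>)) u L\<^sub>h U S \<longrightarrow>
      (\<forall>n. 2 \<le> n \<and> n \<le> N \<longrightarrow>
        (l2_norm \<Omega> (U n))\<^sup>2
          + \<tau> * (\<Sum>k=2..n. (l2_norm \<Omega> (weak_grad \<Omega> (av \<theta> U k)))\<^sup>2)
          + \<gamma> * \<tau> * (\<Sum>k=2..n. (l2_norm \<Omega> (av \<theta> S k))\<^sup>2)
        \<le> C * ((l2_norm \<Omega> (U 0))\<^sup>2 + (l2_norm \<Omega> (u 0))\<^sup>2
               + \<tau> * (\<Sum>k=1..n. (l2_norm \<Omega> (\<lambda>x. g x (real k * \<tau>)))\<^sup>2)))"
    proof (rule exI[of _ \<delta>], rule conjI[OF \<delta>], intro allI impI, elim conjE)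
      fix N :: nat and \<tau> h H :: real and V W and u \<sigma> U S :: "nat \<Rightarrow> real^'d \<Rightarrow> real" and n :: nat
      assume N: "0 < N" and \<tau>_def: "\<tau> = T / real N" and \<tau>_le: "\<tau> \<le> \<delta>"
        and V: "fe_space \<Omega> h V" and W: "fe_space \<Omega> H W"
        and coarse: "coarse_solution \<Omega> \<gamma> \<theta> f \<tau> N (\<lambda>n x. g x (real n * \<tau>)) W u \<sigma>"
        and fine: "fine_solution \<Omega> \<gamma> \<theta> f \<tau> N (\<lambda>n x. g x (real n * \<tau>)) u V U S"
        and n: "2 \<le> n" "n \<le> N"

      \<comment> \<open>The combined energy of both grids and membership of the averages in the
        spaces\<close>
      have \<tau>: "0 < \<tau>"
        using N T by (simp add: \<tau>_def)
      have n\<tau>: "real k * \<tau> \<le> T" if "k \<le> N" for k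
        using that N T by (simp add: \<tau>_def field_simps)
      define G where "G k = (l2_norm \<Omega> (\<lambda>x. g x (real k * \<tau>)))\<^sup>2" for k
      define q where "q k = (l2_norm \<Omega> (U k))\<^sup>2 + (l2_norm \<Omega> (u k))\<^sup>2" for k
      define D where "D k = 4 * \<tau> * (\<gamma> * (l2_norm \<Omega> (av \<theta> S k))\<^sup>2
        + (l2_norm \<Omega> (weak_grad \<Omega> (av \<theta> U k)))\<^sup>2)" for k
      \<comment> \<open>The accumulated dissipation of the fine solution is part of the energy, so
        that Gronwall bounds it as well. The sum is empty at level 1.\<close>
      define P where "P k = energy \<Omega> \<theta> (U k) (U (k-1)) + energy \<Omega> \<theta> (u k) (u (k-1))
        + (\<Sum>j=2..k. D j)" for k
      \<comment> \<open>The two grids each contribute \<open>K\<close>, and the step inequality is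
        multiplied by \<open>4 * \<tau>\<close>.\<close>
      define x where "x = 8 * \<tau> * K"
      have x: "0 \<le> x" "x \<le> 1/2"
        using \<tau> \<tau>_le K by (auto simp: x_def \<delta>_def field_simps)
      have G: "0 \<le> G k" for k
        by (simp add: G_def)
      have D: "0 \<le> D k" for k
        using \<tau> gamma by (simp add: D_def)
      have inV: "U k \<in> V" "S k \<in> V" and inW: "u k \<in> W" "\<sigma> k \<in> W" if "k \<le> N" for k
        using that coarse fine by (auto simp: coarse_solution_def fine_solution_def)
      have L2: "U k \<in> L2 \<Omega>" "u k \<in> L2 \<Omega>" "(\<lambda>x. g x (real k * \<tau>)) \<in> L2 \<Omega>" if "k \<le> N" for k
        using that inV inW fe_space_L2[OF V] fe_space_L2[OF W] gL2 \<tau> n\<tau> by auto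
      have q: "q k + (\<Sum>j=2..k. D j) \<le> P k" if "k \<le> N" for k
        unfolding P_def q_def using that L2 theta
        by (intro add_mono energy_ge) auto
      have sumD: "0 \<le> (\<Sum>j=2..k. D j)" for k
        using D by (simp add: sum_nonneg)
      have q0: "0 \<le> q k" for k
        by (simp add: q_def)
      have qP: "q k \<le> P k" if "k \<le> N" for k
        using q[OF that] sumD[of k] by linarith
      have av1: "\<bar>av1 w y\<bar> \<le> \<bar>w 1 y\<bar> + \<bar>w 0 y\<bar>" for w :: "nat \<Rightarrow> real^'d \<Rightarrow> real" and y
        by (simp add: av1_def)
      have av: "\<bar>av \<theta> w k y\<bar> \<le> \<bar>w k y\<bar> + \<bar>w (k-1) y\<bar>"
        for w :: "nat \<Rightarrow> real^'d \<Rightarrow> real" and k y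
        unfolding av_def using theta by (intro abs_average_le) auto
      have avV: "av \<theta> U k \<in> V" "av \<theta> S k \<in> V" and avW: "av \<theta> u k \<in> W" "av \<theta> \<sigma> k \<in> W" if "k \<le> N" for k
        unfolding av_def using that inV inW
        by (auto intro!: fe_space_lincomb[OF V] fe_space_lincomb[OF W])
      have av1_alt: "av1 w = (\<lambda>y. 1/2 * w 1 y + 1/2 * w 0 y)" for w :: "nat \<Rightarrow> real^'d \<Rightarrow> real"
        by (simp add: av1_def fun_eq_iff field_simps)
      have av1V: "av1 U \<in> V" "av1 S \<in> V" and av1W: "av1 u \<in> W" "av1 \<sigma> \<in> W"
        unfolding av1_alt using n
        by (intro fe_space_lincomb[OF V] fe_space_lincomb[OF W] inV inW; simp)+
      have K_alt: "K = 3 * (2 * L) + 1"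
        by (simp add: K_def)
      have M: "0 \<le> 2 * L" and M_mult: "0 \<le> L * \<bar>a\<bar>" for a
        using L by auto
      have N1: "1 \<le> N"
        using N by simp

      \<comment> \<open>The first time step, coarse and fine\<close>
      have "l2_inner \<Omega> (dt1 \<tau> u) (av1 u) + \<gamma> * (l2_norm \<Omega> (av1 \<sigma>))\<^sup>2
          + (l2_norm \<Omega> (weak_grad \<Omega> (av1 u)))\<^sup>2
        \<le> K * ((l2_norm \<Omega> (u 1))\<^sup>2 + (l2_norm \<Omega> (u 0))\<^sup>2 + (l2_norm \<Omega> (U 1))\<^sup>2
          + (l2_norm \<Omega> (\<lambda>x. g x (real 1 * \<tau>)))\<^sup>2 + (l2_norm \<Omega> (\<lambda>x. g x (real 0 * \<tau>)))\<^sup>2)"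
        unfolding K_alt
      proof (rule step_estimate[OF _ av1W _ _ _ _ _ M _ _ av1])
        show "mixed_eqs \<Omega> \<gamma> W (dt1 \<tau> u) (av1 u) (av1 \<sigma>) (av1 (\<lambda>n x. f (u n x)))
            (av1 (\<lambda>n x. g x (real n * \<tau>)))"
          using coarse N1 by (simp add: coarse_solution_def)
        \<comment> \<open>The nonnegative contribution of \<open>U 1\<close> is added to give the
          coarse bound the same shape as the fine one.\<close>
        show "\<bar>av1 (\<lambda>n x. f (u n x)) y\<bar> \<le> 2 * L * (\<bar>u 1 y\<bar> + \<bar>u 0 y\<bar> + \<bar>U 1 y\<bar>)" for y
          using av1[of "\<lambda>n x. f (u n x)" y] f_le'[of "u 1 y"] f_le'[of "u 0 y"] M_mult[of "U 1 y"]
          by (simp add: algebra_simps)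
        show "\<bar>av1 (\<lambda>n x. g x (real n * \<tau>)) y\<bar> \<le> \<bar>g y (real 1 * \<tau>)\<bar> + \<bar>g y (real 0 * \<tau>)\<bar>" for y
          by (rule av1)
      qed (rule L2, use N in simp)+
      moreover have "l2_inner \<Omega> (dt1 \<tau> U) (av1 U) + \<gamma> * (l2_norm \<Omega> (av1 S))\<^sup>2
          + (l2_norm \<Omega> (weak_grad \<Omega> (av1 U)))\<^sup>2
        \<le> K * ((l2_norm \<Omega> (U 1))\<^sup>2 + (l2_norm \<Omega> (U 0))\<^sup>2 + (l2_norm \<Omega> (u 1))\<^sup>2
          + (l2_norm \<Omega> (\<lambda>x. g x (real 1 * \<tau>)))\<^sup>2 + (l2_norm \<Omega> (\<lambda>x. g x (real 0 * \<tau>)))\<^sup>2)"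
        unfolding K_alt
      proof (rule step_estimate[OF _ av1V _ _ _ _ _ M _ _ av1])
        show "mixed_eqs \<Omega> \<gamma> V (dt1 \<tau> U) (av1 U) (av1 S)
            (\<lambda>x. (linearized f (U 1) (u 1) x + f (U 0 x)) / 2) (av1 (\<lambda>n x. g x (real n * \<tau>)))"
          using fine N1 by (simp add: fine_solution_def)
        show "\<bar>(linearized f (U 1) (u 1) y + f (U 0 y)) / 2\<bar>
            \<le> 2 * L * (\<bar>U 1 y\<bar> + \<bar>U 0 y\<bar> + \<bar>u 1 y\<bar>)" for y
          using lin_le[of "U 1" "u 1" y] f_le'[of "U 0 y"] by (simp add: algebra_simps)
        show "\<bar>av1 (\<lambda>n x. g x (real n * \<tau>)) y\<bar> \<le> \<bar>g y (real 1 * \<tau>)\<bar> + \<bar>g y (real 0 * \<tau>)\<bar>" for y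
          by (rule av1)
      qed (rule L2, use N in simp)+
      moreover have "0 \<le> \<gamma> * (l2_norm \<Omega> (av1 S))\<^sup>2" "0 \<le> \<gamma> * (l2_norm \<Omega> (av1 \<sigma>))\<^sup>2"
        "0 \<le> (l2_norm \<Omega> (weak_grad \<Omega> (av1 U)))\<^sup>2" "0 \<le> (l2_norm \<Omega> (weak_grad \<Omega> (av1 u)))\<^sup>2"
        using gamma by auto
      moreover have "K * ((l2_norm \<Omega> (u 1))\<^sup>2 + (l2_norm \<Omega> (u 0))\<^sup>2 + (l2_norm \<Omega> (U 1))\<^sup>2
          + G 1 + G 0) \<le> K * (q 1 + q 0 + G 1 + G 0)"
        "K * ((l2_norm \<Omega> (U 1))\<^sup>2 + (l2_norm \<Omega> (U 0))\<^sup>2 + (l2_norm \<Omega> (u 1))\<^sup>2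
          + G 1 + G 0) \<le> K * (q 1 + q 0 + G 1 + G 0)"
        using K by (auto simp: q_def)
      ultimately have "l2_inner \<Omega> (dt1 \<tau> u) (av1 u) + l2_inner \<Omega> (dt1 \<tau> U) (av1 U)
          \<le> 2 * (K * (q 1 + q 0 + G 1 + G 0))"
        unfolding G_def by linarith
      \<comment> \<open>The factor turns the left side into \<open>q 1 - q 0\<close> by
        \<open>l2_inner_dt1_av1\<close>, and the right side carries \<open>4 * \<tau> * K\<close>,
        which is \<open>x / 2\<close>.\<close>
      then have "2 * \<tau> * (l2_inner \<Omega> (dt1 \<tau> u) (av1 u) + l2_inner \<Omega> (dt1 \<tau> U) (av1 U))
          \<le> 2 * \<tau> * (2 * (K * (q 1 + q 0 + G 1 + G 0)))"
        using \<tau> by (intro mult_left_mono) auto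
      moreover have "2 * \<tau> * (l2_inner \<Omega> (dt1 \<tau> u) (av1 u) + l2_inner \<Omega> (dt1 \<tau> U) (av1 U)) = q 1 - q 0"
        using l2_inner_dt1_av1[OF \<tau> L2(2)[OF N1] L2(2)[OF le0]]
          l2_inner_dt1_av1[OF \<tau> L2(1)[OF N1] L2(1)[OF le0]]
        by (simp add: q_def algebra_simps)
      ultimately have first: "q 1 - q 0 \<le> x / 2 * (q 1 + q 0 + G 1 + G 0)"
        by (simp add: x_def mult_ac)

      \<comment> \<open>The later time steps\<close>
      have step: "P k - P (k-1) \<le> x * (P k + P (k-1) + (G k + G (k-1)))" if k: "2 \<le> k" "k \<le> n" for k
      proof -
        have kN: "k \<le> N" "k - 1 \<le> N" "k - 2 \<le> N" "k \<in> {2..N}"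
          using k n by auto
        have "l2_inner \<Omega> (dt \<theta> \<tau> u k) (av \<theta> u k) + \<gamma> * (l2_norm \<Omega> (av \<theta> \<sigma> k))\<^sup>2
            + (l2_norm \<Omega> (weak_grad \<Omega> (av \<theta> u k)))\<^sup>2
          \<le> K * ((l2_norm \<Omega> (u k))\<^sup>2 + (l2_norm \<Omega> (u (k-1)))\<^sup>2 + (l2_norm \<Omega> (U k))\<^sup>2
            + (l2_norm \<Omega> (\<lambda>x. g x (real k * \<tau>)))\<^sup>2 + (l2_norm \<Omega> (\<lambda>x. g x (real (k-1) * \<tau>)))\<^sup>2)"
          unfolding K_alt
        proof (rule step_estimate[OF _ avW _ _ _ _ _ M _ _ av])
          show "mixed_eqs \<Omega> \<gamma> W (dt \<theta> \<tau> u k) (av \<theta> u k) (av \<theta> \<sigma> k) (av \<theta> (\<lambda>n x. f (u n x)) k)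
              (av \<theta> (\<lambda>n x. g x (real n * \<tau>)) k)"
            using coarse kN(4) by (simp add: coarse_solution_def)
          show "\<bar>av \<theta> (\<lambda>n x. f (u n x)) k y\<bar> \<le> 2 * L * (\<bar>u k y\<bar> + \<bar>u (k-1) y\<bar> + \<bar>U k y\<bar>)" for y
            using av[of "\<lambda>n x. f (u n x)" k y] f_le'[of "u k y"] f_le'[of "u (k-1) y"]
              M_mult[of "U k y"]
            by (simp add: algebra_simps)
          show "\<bar>av \<theta> (\<lambda>n x. g x (real n * \<tau>)) k y\<bar>
              \<le> \<bar>g y (real k * \<tau>)\<bar> + \<bar>g y (real (k-1) * \<tau>)\<bar>" for y
            by (rule av)
        qed (use kN in \<open>simp_all only: L2\<close>)
        moreover have "l2_inner \<Omega> (dt \<theta> \<tau> U k) (av \<theta> U k) + \<gamma> * (l2_norm \<Omega> (av \<theta> S k))\<^sup>2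
            + (l2_norm \<Omega> (weak_grad \<Omega> (av \<theta> U k)))\<^sup>2
          \<le> K * ((l2_norm \<Omega> (U k))\<^sup>2 + (l2_norm \<Omega> (U (k-1)))\<^sup>2 + (l2_norm \<Omega> (u k))\<^sup>2
            + (l2_norm \<Omega> (\<lambda>x. g x (real k * \<tau>)))\<^sup>2 + (l2_norm \<Omega> (\<lambda>x. g x (real (k-1) * \<tau>)))\<^sup>2)"
          unfolding K_alt
        proof (rule step_estimate[OF _ avV _ _ _ _ _ M _ _ av])
          show "mixed_eqs \<Omega> \<gamma> V (dt \<theta> \<tau> U k) (av \<theta> U k) (av \<theta> S k)
              (\<lambda>x. (1 - \<theta>) * linearized f (U k) (u k) x + \<theta> * f (U (k-1) x))
              (av \<theta> (\<lambda>n x. g x (real n * \<tau>)) k)"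
            using fine kN(4) by (simp add: fine_solution_def)
          show "\<bar>(1 - \<theta>) * linearized f (U k) (u k) y + \<theta> * f (U (k-1) y)\<bar>
              \<le> 2 * L * (\<bar>U k y\<bar> + \<bar>U (k-1) y\<bar> + \<bar>u k y\<bar>)" for y
          proof -
            have "\<bar>(1 - \<theta>) * linearized f (U k) (u k) y + \<theta> * f (U (k-1) y)\<bar>
                \<le> \<bar>linearized f (U k) (u k) y\<bar> + \<bar>f (U (k-1) y)\<bar>"
              using theta by (intro abs_average_le) auto
            then show ?thesis
              using lin_le[of "U k" "u k" y] f_le'[of "U (k-1) y"] by (simp add: algebra_simps)
          qed
          show "\<bar>av \<theta> (\<lambda>n x. g x (real n * \<tau>)) k y\<bar>
              \<le> \<bar>g y (real k * \<tau>)\<bar> + \<bar>g y (real (k-1) * \<tau>)\<bar>" for y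
            by (rule av)
        qed (use kN in \<open>simp_all only: L2\<close>)
        moreover have "0 \<le> \<gamma> * (l2_norm \<Omega> (av \<theta> \<sigma> k))\<^sup>2"
          "0 \<le> (l2_norm \<Omega> (weak_grad \<Omega> (av \<theta> u k)))\<^sup>2"
          using gamma by auto
        moreover have "K * ((l2_norm \<Omega> (u k))\<^sup>2 + (l2_norm \<Omega> (u (k-1)))\<^sup>2 + (l2_norm \<Omega> (U k))\<^sup>2
            + G k + G (k-1)) \<le> K * (P k + P (k-1) + (G k + G (k-1)))"
          "K * ((l2_norm \<Omega> (U k))\<^sup>2 + (l2_norm \<Omega> (U (k-1)))\<^sup>2 + (l2_norm \<Omega> (u k))\<^sup>2
            + G k + G (k-1)) \<le> K * (P k + P (k-1) + (G k + G (k-1)))"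
        proof -
          \<comment> \<open>The linearization couples the grids at the newest level only: both norms
            there fit together into \<open>P k\<close>, while the single older norm fits into
            \<open>P (k-1)\<close>.\<close>
          have "(l2_norm \<Omega> (u k))\<^sup>2 + (l2_norm \<Omega> (U k))\<^sup>2 \<le> P k"
            "(l2_norm \<Omega> (U (k-1)))\<^sup>2 \<le> P (k-1)" "(l2_norm \<Omega> (u (k-1)))\<^sup>2 \<le> P (k-1)"
            using qP[OF kN(1)] qP[OF kN(2)] unfolding q_def
            by (smt (verit) zero_le_power2)+
          then show "K * ((l2_norm \<Omega> (u k))\<^sup>2 + (l2_norm \<Omega> (u (k-1)))\<^sup>2 + (l2_norm \<Omega> (U k))\<^sup>2
            + G k + G (k-1)) \<le> K * (P k + P (k-1) + (G k + G (k-1)))"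
          "K * ((l2_norm \<Omega> (U k))\<^sup>2 + (l2_norm \<Omega> (U (k-1)))\<^sup>2 + (l2_norm \<Omega> (u k))\<^sup>2
            + G k + G (k-1)) \<le> K * (P k + P (k-1) + (G k + G (k-1)))"
            using K by (auto intro!: mult_left_mono)
        qed
        ultimately have "l2_inner \<Omega> (dt \<theta> \<tau> u k) (av \<theta> u k) + l2_inner \<Omega> (dt \<theta> \<tau> U k) (av \<theta> U k)
            + (\<gamma> * (l2_norm \<Omega> (av \<theta> S k))\<^sup>2 + (l2_norm \<Omega> (weak_grad \<Omega> (av \<theta> U k)))\<^sup>2)
          \<le> 2 * (K * (P k + P (k-1) + (G k + G (k-1))))"
          unfolding G_def by linarith
        \<comment> \<open>The factor matches \<open>energy_diff_le\<close> and the weight in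
          \<open>D\<close>.\<close>
        then have "4 * \<tau> * (l2_inner \<Omega> (dt \<theta> \<tau> u k) (av \<theta> u k) + l2_inner \<Omega> (dt \<theta> \<tau> U k) (av \<theta> U k)
            + (\<gamma> * (l2_norm \<Omega> (av \<theta> S k))\<^sup>2 + (l2_norm \<Omega> (weak_grad \<Omega> (av \<theta> U k)))\<^sup>2))
          \<le> 4 * \<tau> * (2 * (K * (P k + P (k-1) + (G k + G (k-1)))))"
          using \<tau> by (intro mult_left_mono) auto
        then have "4 * \<tau> * l2_inner \<Omega> (dt \<theta> \<tau> u k) (av \<theta> u k)
            + 4 * \<tau> * l2_inner \<Omega> (dt \<theta> \<tau> U k) (av \<theta> U k) + D k
          \<le> x * (P k + P (k-1) + (G k + G (k-1)))"
          by (simp add: distrib_left D_def x_def mult_ac)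
        moreover have "(\<Sum>j=2..k. D j) = (\<Sum>j=2..k-1. D j) + D k"
          using k by (cases k) auto
        \<comment> \<open>Identifies the older argument of the energies in \<open>P (k-1)\<close>
          with the level \<open>k - 2\<close> used by \<open>dt\<close>.\<close>
        moreover have "k - 1 - 1 = k - 2"
          by simp
        ultimately show ?thesis
          using energy_diff_le[where u = u and n = k, OF theta \<tau> L2(2)[OF kN(1)] L2(2)[OF kN(2)] L2(2)[OF kN(3)]]
            energy_diff_le[where u = U and n = k, OF theta \<tau> L2(1)[OF kN(1)] L2(1)[OF kN(2)] L2(1)[OF kN(3)]]
          unfolding P_def by simp
      qed

      \<comment> \<open>Gronwall and the final estimate\<close>
      have "\<tau> < d"
        using \<tau>_le d by (simp add: \<delta>_def)
      then have "G 0 \<le> 4 * G 1"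
        using g0[of \<tau>] \<tau> n\<tau>[OF N1] by (simp add: G_def)
      moreover have "P 1 \<le> 10 * (q 1 + q 0)"
        using energy_le[OF theta L2(1)[OF N1] L2(1)[OF le0]]
          energy_le[OF theta L2(2)[OF N1] L2(2)[OF le0]]
        by (simp add: P_def q_def)
      moreover have "0 \<le> P k" if "k \<le> n" for k
        using that n qP[of k] q0[of k] by linarith
      ultimately have "P n \<le> exp (4 * x * real n) * (30 * q 0 + 44 * x * (\<Sum>k=1..n. G k))"
        using x n G q0 first step by (intro energy_sum_bound) auto
      also have "\<dots> \<le> exp (32 * K * T) * ((30 + 352 * K) * (q 0 + \<tau> * (\<Sum>k=1..n. G k)))"
      proof (intro mult_mono)
        have "K * (real n * \<tau>) \<le> K * T"
          using n\<tau>[OF n(2)] K by (intro mult_left_mono) auto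
        then show "exp (4 * x * real n) \<le> exp (32 * K * T)"
          by (simp add: x_def mult_ac)
        have "0 \<le> K * q 0" "0 \<le> \<tau> * (\<Sum>k=1..n. G k)"
          using K q0 \<tau> G by (simp_all add: sum_nonneg)
        \<comment> \<open>Expanding the product on the right yields both terms on the left plus two
          nonnegative cross terms.\<close>
        then show "30 * q 0 + 44 * x * (\<Sum>k=1..n. G k)
            \<le> (30 + 352 * K) * (q 0 + \<tau> * (\<Sum>k=1..n. G k))"
          by (simp add: x_def algebra_simps)
        show "0 \<le> 30 * q 0 + 44 * x * (\<Sum>k=1..n. G k)"
          using q0 x G by (simp add: sum_nonneg)
      qed auto
      finally have bound: "P n \<le> C * (q 0 + \<tau> * (\<Sum>k=1..n. G k))"
        by (simp add: C_def mult_ac)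
      \<comment> \<open>\<open>D\<close> carries the weight \<open>4 * \<tau>\<close>, so the
        dissipation in the claim is a quarter of the sum contained in \<open>P n\<close>.\<close>
      have "\<tau> * (\<Sum>k=2..n. (l2_norm \<Omega> (weak_grad \<Omega> (av \<theta> U k)))\<^sup>2)
          + \<gamma> * \<tau> * (\<Sum>k=2..n. (l2_norm \<Omega> (av \<theta> S k))\<^sup>2) = (\<Sum>k=2..n. D k) / 4"
        by (simp add: D_def sum_distrib_left sum_divide_distrib sum.distrib[symmetric]
            add_divide_distrib algebra_simps)
      moreover have "(l2_norm \<Omega> (U n))\<^sup>2 \<le> q n"
        by (simp add: q_def)
      ultimately have "(l2_norm \<Omega> (U n))\<^sup>2
          + \<tau> * (\<Sum>k=2..n. (l2_norm \<Omega> (weak_grad \<Omega> (av \<theta> U k)))\<^sup>2)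
          + \<gamma> * \<tau> * (\<Sum>k=2..n. (l2_norm \<Omega> (av \<theta> S k))\<^sup>2) \<le> P n"
        using q[OF n(2)] sumD[of n] by linarith
      also note bound
      finally show "(l2_norm \<Omega> (U n))\<^sup>2
          + \<tau> * (\<Sum>k=2..n. (l2_norm \<Omega> (weak_grad \<Omega> (av \<theta> U k)))\<^sup>2)
          + \<gamma> * \<tau> * (\<Sum>k=2..n. (l2_norm \<Omega> (av \<theta> S k))\<^sup>2)
        \<le> C * ((l2_norm \<Omega> (U 0))\<^sup>2 + (l2_norm \<Omega> (u 0))\<^sup>2
               + \<tau> * (\<Sum>k=1..n. (l2_norm \<Omega> (\<lambda>x. g x (real k * \<tau>)))\<^sup>2))"
        by (simp add: q_def G_def)
    qed
  qed
qed

end
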